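(* Let $\alpha_1, A_1, \beta_2, B_2 > 0$ and consider the system of difference equations $$x_{n+1}=\frac{\alpha_{1}}{A_{1}+y_{n}},\qquad y_{n+1}=\frac{\beta_{2}}{B_{2}},\qquad n=0,1,2,\dots,$$ with arbitrary nonnegative initial conditions $x_0,y_0$. This system has a unique equilibrium $$(\bar{x},\bar{y})=\left(\frac{B_{2}\alpha_{1}}{B_{2}A_{1}+\beta_{2}},\frac{\beta_{2}}{B_{2}}\right).$$ Moreover, every solution is equal to the equilibrium after at most two steps, i.e. $(x_n,y_n)=(\bar x,\bar y)$ for all $n\ge 2$.
   Context: The state space consists of nonnegative points. An equilibrium is a point $(\bar x,\bar y)\in[0,\infty)^2$ such that the constant sequence $(x_n,y_n)=(\bar x,\bar y)$ solves the system. *)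

theory Defs
  imports Complex_Main
begin

definition is_solution ::
  "real \<Rightarrow> real \<Rightarrow> real \<Rightarrow> real \<Rightarrow> (nat \<Rightarrow> real) \<Rightarrow> (nat \<Rightarrow> real) \<Rightarrow> bool" where
  "is_solution \<alpha>\<^sub>1 A\<^sub>1 \<beta>\<^sub>2 B\<^sub>2 x y \<longleftrightarrow>
     x 0 \<ge> 0 \<and> y 0 \<ge> 0 \<and>
     (\<forall>n. x (Suc n) = \<alpha>\<^sub>1 / (A\<^sub>1 + y n) \<and> y (Suc n) = \<beta>\<^sub>2 / B\<^sub>2)"

definition is_equilibrium ::
  "real \<Rightarrow> real \<Rightarrow> real \<Rightarrow> real \<Rightarrow> real \<times> real \<Rightarrow> bool" where
  "is_equilibrium \<alpha>\<^sub>1 A\<^sub>1 \<beta>\<^sub>2 B\<^sub>2 p \<longleftrightarrow>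
     p \<in> {0..} \<times> {0..} \<and>
     is_solution \<alpha>\<^sub>1 A\<^sub>1 \<beta>\<^sub>2 B\<^sub>2 (\<lambda>_. fst p) (\<lambda>_. snd p)"

end

theory Submission
  imports Defs
begin

text \<open>The map forgets the past: every new y is the constant
  \<open>\<beta>\<^sub>2 / B\<^sub>2\<close>, and the new x depends only on the previous y. So y is
  settled from index 1 on, and x, lagging one step behind, from index 2 on. Uniqueness of the
  equilibrium then comes for free from \<open>reach\<close>, since an equilibrium is itself a
  constant solution.\<close>

theorem theorem5:
  fixes \<alpha>\<^sub>1 A\<^sub>1 \<beta>\<^sub>2 B\<^sub>2 :: real
  assumes "\<alpha>\<^sub>1 > 0" and "A\<^sub>1 > 0" and "\<beta>\<^sub>2 > 0" and "B\<^sub>2 > 0"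
  defines "e \<equiv> (B\<^sub>2 * \<alpha>\<^sub>1 / (B\<^sub>2 * A\<^sub>1 + \<beta>\<^sub>2), \<beta>\<^sub>2 / B\<^sub>2)"
  shows "is_equilibrium \<alpha>\<^sub>1 A\<^sub>1 \<beta>\<^sub>2 B\<^sub>2 e \<and>
         (\<forall>p. is_equilibrium \<alpha>\<^sub>1 A\<^sub>1 \<beta>\<^sub>2 B\<^sub>2 p \<longrightarrow> p = e) \<and>
         (\<forall>x y. is_solution \<alpha>\<^sub>1 A\<^sub>1 \<beta>\<^sub>2 B\<^sub>2 x y \<longrightarrow> (\<forall>n\<ge>2. (x n, y n) = e))"
proof -
  \<comment> \<open>Multiplying through by \<open>B\<^sub>2\<close> gives the closed form of x once
    y has settled.\<close>
  have key: "\<alpha>\<^sub>1 / (A\<^sub>1 + \<beta>\<^sub>2 / B\<^sub>2) = B\<^sub>2 * \<alpha>\<^sub>1 / (B\<^sub>2 * A\<^sub>1 + \<beta>\<^sub>2)"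
    using assms(4) by (simp add: add_divide_eq_iff mult.commute)
  have equilibrium: "is_equilibrium \<alpha>\<^sub>1 A\<^sub>1 \<beta>\<^sub>2 B\<^sub>2 e"
    using assms(1-4) by (simp add: is_equilibrium_def is_solution_def e_def key)
  have reach: "(x n, y n) = e"
    if sol: "is_solution \<alpha>\<^sub>1 A\<^sub>1 \<beta>\<^sub>2 B\<^sub>2 x y" and "n \<ge> 2" for x y n
  proof -
    \<comment> \<open>Two successors are exposed because x at index n is computed from y at n - 1,
      which is forced only if n - 1 is itself a successor.\<close>
    obtain m where "n = Suc (Suc m)"
      using \<open>n \<ge> 2\<close> by (metis add_2_eq_Suc le_Suc_ex)
    then show ?thesis
      using sol by (simp add: is_solution_def e_def key)
  qed
  \<comment> \<open>The constant sequence at p takes the value p at index 2, where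
    \<open>reach\<close> already forces \<open>e\<close>.\<close>
  have "p = e" if "is_equilibrium \<alpha>\<^sub>1 A\<^sub>1 \<beta>\<^sub>2 B\<^sub>2 p" for p
    using that reach[of "\<lambda>_. fst p" "\<lambda>_. snd p" 2] by (simp add: is_equilibrium_def)
  with equilibrium reach show ?thesis
    by blast
qed

end
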